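(* Fix sequences $N=N_n$, $D=D_n$, a distribution $\mathbb{Q}=\mathbb{Q}_n$ on $\mathbb{R}^N$, and $\mathcal{R}=\mathcal{R}_n\subseteq\mathbb{R}^N$, and assume that for each $n$, $\mathbb{Q}$ is supported on a finite set and $\mathcal{R}$ is finite. Then the following are equivalent: (1) no degree-$D$ polynomial strongly separates $\mathbb{Q}$ and $\mathcal{R}$; (2) for an infinite subsequence of values of $n$ there exists a distribution $\mathbb{P}=\mathbb{P}_n$ supported on $\mathcal{R}$ with $\mathrm{Adv}_{\le D}(\mathbb{P},\mathbb{Q})=O(1)$. Similarly, the following are equivalent: (1') no degree-$D$ polynomial weakly separates $\mathbb{Q}$ and $\mathcal{R}$; (2') for an infinite subsequence of values of $n$ there exists a distribution $\mathbb{P}=\mathbb{P}_n$ supported on $\mathcal{R}$ with $\mathrm{Adv}_{\le D}(\mathbb{P},\mathbb{Q})=1+o(1)$.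
   Context: $\mathrm{Adv}_{\le D}(\mathbb{P},\mathbb{Q})\coloneqq\sup_f \mathbb{E}_{\mathbb{P}}[f]/\sqrt{\mathbb{E}_{\mathbb{Q}}[f^2]}$ over polynomials $f:\mathbb{R}^N\to\mathbb{R}$ of degree at most $D$. A polynomial $f=f_n$ strongly separates $\mathbb{Q}$ and $\mathcal{R}$ if $f(X)\ge1$ for all $X\in\mathcal{R}$ and $\mathbb{E}_{\mathbb{Q}}[f^2]=o(1)$; it weakly separates them if $f(X)\ge1$ for all $X\in\mathcal{R}$, $\mathbb{E}_{\mathbb{Q}}[f]=0$ and $\mathbb{E}_{\mathbb{Q}}[f^2]=O(1)$ (asymptotics as $n\to\infty$). *)

theory Defs
  imports "HOL-Probability.Probability" "HOL-Library.Poly_Mapping" "HOL-Library.Landau_Symbols"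
begin

text \<open>
  The dimension varies with \<open>n\<close>, so \<open>\<real>\<^sup>N\<close> is the set of extensional functions on
  \<open>{..<N}\<close>: every vector has exactly one representative. Since all distributions involved
  have finite support, they are modelled by type \<open>pmf\<close>.
\<close>

definition rspace :: "nat \<Rightarrow> (nat \<Rightarrow> real) set" where
  "rspace N = ({..<N} \<rightarrow>\<^sub>E UNIV)"

text \<open>Keys are exponent vectors; values are coefficients.\<close>

type_synonym real_mpoly = "(nat \<Rightarrow>\<^sub>0 nat) \<Rightarrow>\<^sub>0 real"

definition monom_deg :: "(nat \<Rightarrow>\<^sub>0 nat) \<Rightarrow> nat" where
  "monom_deg m = (\<Sum>i\<in>Poly_Mapping.keys m. Poly_Mapping.lookup m i)"

definition peval :: "real_mpoly \<Rightarrow> (nat \<Rightarrow> real) \<Rightarrow> real" where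
  "peval p x = (\<Sum>m\<in>Poly_Mapping.keys p. Poly_Mapping.lookup p m *
     (\<Prod>i\<in>Poly_Mapping.keys m. x i ^ Poly_Mapping.lookup m i))"

definition polys_le :: "nat \<Rightarrow> nat \<Rightarrow> real_mpoly set" where
  "polys_le N D =
     {p. \<forall>m\<in>Poly_Mapping.keys p. Poly_Mapping.keys m \<subseteq> {..<N} \<and> monom_deg m \<le> D}"

text \<open>
  The quotient is taken in \<open>ereal\<close>, where \<open>c / 0\<close> is \<open>\<infinity>\<close>, \<open>0\<close> or \<open>-\<infinity>\<close> according to the
  sign of \<open>c\<close>. Omitting the polynomials with vanishing second moment would give the same
  supremum: if \<open>f\<close> is such a polynomial with positive mean under \<open>P\<close>, then \<open>1 + t f\<close> has
  second moment \<open>1\<close> under \<open>Q\<close> and unbounded mean under \<open>P\<close> as \<open>t\<close> grows. The value is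
  always at least \<open>1\<close>, as \<open>f = 1\<close> shows.
\<close>

definition Adv :: "nat \<Rightarrow> nat \<Rightarrow> (nat \<Rightarrow> real) pmf \<Rightarrow> (nat \<Rightarrow> real) pmf \<Rightarrow> ereal" where
  "Adv N D P Q = (SUP f\<in>polys_le N D.
     ereal (measure_pmf.expectation P (peval f)) /
     ereal (sqrt (measure_pmf.expectation Q (\<lambda>x. (peval f x)\<^sup>2))))"

text \<open>
  Separation is a property of the sequence \<open>f\<close> as \<open>n\<close> tends to infinity, so the pointwise
  conditions are imposed for all sufficiently large \<open>n\<close>. For weak separation this matters:
  at a single \<open>n\<close> there may be no mean-zero polynomial that is at least \<open>1\<close> on \<open>R n\<close>
  (for instance if \<open>Q n\<close> is a point mass at an element of \<open>R n\<close>). For strong separation it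
  makes no difference to the existence of a separating sequence, since finitely many terms
  can be replaced by the constant \<open>1\<close>.
\<close>

definition strongly_separates ::
  "(nat \<Rightarrow> real_mpoly) \<Rightarrow> (nat \<Rightarrow> (nat \<Rightarrow> real) pmf) \<Rightarrow> (nat \<Rightarrow> (nat \<Rightarrow> real) set) \<Rightarrow> bool" where
  "strongly_separates f Q R \<longleftrightarrow>
     (\<forall>\<^sub>F n in sequentially. \<forall>x\<in>R n. peval (f n) x \<ge> 1) \<and>
     (\<lambda>n. measure_pmf.expectation (Q n) (\<lambda>x. (peval (f n) x)\<^sup>2)) \<in> o(\<lambda>_. 1)"

definition weakly_separates ::
  "(nat \<Rightarrow> real_mpoly) \<Rightarrow> (nat \<Rightarrow> (nat \<Rightarrow> real) pmf) \<Rightarrow> (nat \<Rightarrow> (nat \<Rightarrow> real) set) \<Rightarrow> bool" where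
  "weakly_separates f Q R \<longleftrightarrow>
     (\<forall>\<^sub>F n in sequentially. \<forall>x\<in>R n. peval (f n) x \<ge> 1) \<and>
     (\<forall>\<^sub>F n in sequentially. measure_pmf.expectation (Q n) (peval (f n)) = 0) \<and>
     (\<lambda>n. measure_pmf.expectation (Q n) (\<lambda>x. (peval (f n) x)\<^sup>2)) \<in> O(\<lambda>_. 1)"

end

theory Submission imports Defs begin

text \<open>
  Fix \<open>n\<close>. If every \<open>f \<ge> 1\<close> on \<open>R\<close> in a linear space \<open>W\<close> of functions has \<open>E\<^sub>Q f\<^sup>2 \<ge> s\<close>, then the
  convex set of all \<open>f \<in> W\<close> with \<open>E\<^sub>Q f\<^sup>2 < s\<close> contains no \<open>f\<close> exceeding \<open>1\<close> everywhere on \<open>R\<close>, so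
  by a minimax argument one distribution \<open>P\<close> on \<open>R\<close> satisfies \<open>E\<^sub>P f \<le> 1\<close> for all of them; by
  homogeneity \<open>sqrt s * E\<^sub>P f \<le> sqrt (E\<^sub>Q f\<^sup>2)\<close> on \<open>W\<close>. With \<open>W\<close> the polynomials of degree at
  most \<open>D\<close> this bounds the advantage by \<open>1 / sqrt s\<close>. With \<open>W\<close> the polynomials of \<open>Q\<close>-mean zero
  it bounds it by \<open>sqrt (1 + 1 / s)\<close>, after splitting off the mean. Conversely, a separating \<open>f\<close>
  (or \<open>1 + t f\<close> for a suitable \<open>t\<close>, in the weak case) witnesses a lower bound of the same form.
\<close>

subsection \<open>A theorem of the alternative\<close>

text \<open>Ky Fan's convexlike condition: the points indexed by \<open>I\<close> that lie above
  some point of the image of \<open>T\<close> form a convex set. Since \<open>z\<close> only has to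
  dominate the combination, \<open>T\<close> needs no linear structure.\<close>

definition convexlike_on :: "'b set \<Rightarrow> 'i set \<Rightarrow> ('i \<Rightarrow> 'b \<Rightarrow> real) \<Rightarrow> bool" where
  "convexlike_on T I g \<longleftrightarrow>
     (\<forall>x\<in>T. \<forall>y\<in>T. \<forall>t\<in>{0..1}. \<exists>z\<in>T. \<forall>i\<in>I. g i z \<le> t * g i x + (1 - t) * g i y)"

lemma convexlike_onD:
  assumes "convexlike_on T I g" "x \<in> T" "y \<in> T" "0 \<le> t" "t \<le> 1"
  obtains z where "z \<in> T" "\<And>i. i \<in> I \<Longrightarrow> g i z \<le> t * g i x + (1 - t) * g i y"
  using assms unfolding convexlike_on_def by (metis atLeastAtMost_iff)

text \<open>Each point with \<open>a < 0\<close> bounds the weight \<open>l\<close> from above, each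
  point with \<open>b < 0\<close> from below. Convexity makes all these bounds compatible, so the
  supremum of the lower ones is a valid weight.\<close>

lemma alternative_two:
  fixes a b :: "'b \<Rightarrow> real"
  assumes conv: "\<And>x y t. x \<in> T \<Longrightarrow> y \<in> T \<Longrightarrow> 0 \<le> t \<Longrightarrow> t \<le> 1 \<Longrightarrow>
      \<exists>z\<in>T. a z \<le> t * a x + (1 - t) * a y \<and> b z \<le> t * b x + (1 - t) * b y"
    and nonneg: "\<And>x. x \<in> T \<Longrightarrow> a x \<ge> 0 \<or> b x \<ge> 0"
  obtains l where "0 \<le> l" "l \<le> 1" "\<And>x. x \<in> T \<Longrightarrow> l * a x + (1 - l) * b x \<ge> 0"
proof -
  \<comment> \<open>After clearing denominators this says that the lower bound imposed by
    \<open>y\<close> is at most the upper bound imposed by \<open>x\<close>. Otherwise some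
    combination of the two points is negative in both coordinates.\<close>
  have cross: "a x * b y \<le> a y * b x" if x: "x \<in> T" "a x < 0" and y: "y \<in> T" "b y < 0" for x y
  proof (rule ccontr)
    assume "\<not> ?thesis"
    then have neg: "a y * b x - a x * b y < 0" by simp
    have "b x \<ge> 0" "a y \<ge> 0" using nonneg x y by force+
    define s where "s = a y - b y + b x - a x"
    have s: "s > 0" using \<open>b x \<ge> 0\<close> \<open>a y \<ge> 0\<close> x y by (simp add: s_def)
    \<comment> \<open>the weight for which both coordinates of the convex combination agree\<close>
    define t where "t = (a y - b y) / s"
    have t: "0 \<le> t" "t \<le> 1" "1 - t = (b x - a x) / s"
      using s \<open>b x \<ge> 0\<close> \<open>a y \<ge> 0\<close> x y by (simp_all add: t_def s_def field_simps)
    have "t * a x + (1 - t) * a y = (a y * b x - a x * b y) / s"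
      "t * b x + (1 - t) * b y = (a y * b x - a x * b y) / s"
      unfolding t(3) by (simp_all add: t_def add_divide_distrib[symmetric] algebra_simps)
    moreover have "(a y * b x - a x * b y) / s < 0" using neg s by (simp add: divide_neg_pos)
    moreover obtain z where "z \<in> T" "a z \<le> t * a x + (1 - t) * a y" "b z \<le> t * b x + (1 - t) * b y"
      using conv[OF x(1) y(1) t(1,2)] by blast
    ultimately show False using nonneg[of z] by linarith
  qed
  \<comment> \<open>\<open>S\<close> collects the lower bounds on the weight. Inserting 0 keeps it
    nonempty and makes its supremum nonnegative.\<close>
  define S where "S = insert 0 ((\<lambda>y. - b y / (a y - b y)) ` {y \<in> T. b y < 0})"
  have S1: "s \<le> 1" if "s \<in> S" for s
  proof -
    have "- b y / (a y - b y) \<le> 1" if "y \<in> T" "b y < 0" for y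
      using nonneg[of y] that by (simp add: pos_divide_le_eq del: divide_minus_left)
    then show ?thesis using that by (auto simp: S_def)
  qed
  then have bdd: "bdd_above S" by (auto simp: bdd_above_def)
  have ne: "S \<noteq> {}" by (simp add: S_def)
  show thesis
  proof (rule that[of "Sup S"])
    show "0 \<le> Sup S" using bdd by (auto intro: cSup_upper simp: S_def)
    show "Sup S \<le> 1" using S1 ne by (auto intro: cSup_least)
    fix x assume x: "x \<in> T"
    consider "a x < 0" | "b x < 0" | "a x \<ge> 0" "b x \<ge> 0" by linarith
    then show "Sup S * a x + (1 - Sup S) * b x \<ge> 0"
    proof cases
      case 1
      then have bx: "b x \<ge> 0" using nonneg[OF x] by simp
      have "Sup S \<le> b x / (b x - a x)"
      proof (rule cSup_least[OF ne])
        fix s assume "s \<in> S"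
        then consider "s = 0" | y where "y \<in> T" "b y < 0" "s = - b y / (a y - b y)"
          by (auto simp: S_def)
        then show "s \<le> b x / (b x - a x)"
        proof cases
          case 1
          then show ?thesis using bx \<open>a x < 0\<close> by simp
        next
          case y: 2
          have "a y \<ge> 0" using nonneg[of y] y by simp
          then show ?thesis
            using cross[OF x 1 y(1,2)] 1 y bx by (simp add: y(3) frac_le_eq field_simps)
        qed
      qed
      then show ?thesis using 1 bx by (simp add: pos_le_divide_eq algebra_simps)
    next
      case 2
      then have ax: "a x \<ge> 0" using nonneg[OF x] by simp
      have "- b x / (a x - b x) \<le> Sup S"
        using 2 x bdd by (auto intro: cSup_upper simp: S_def)
      then have "- b x \<le> Sup S * (a x - b x)"
        using 2 ax by (simp add: pos_divide_le_eq del: divide_minus_left)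
      then show ?thesis by (simp add: algebra_simps)
    next
      case 3
      then show ?thesis using \<open>0 \<le> Sup S\<close> \<open>Sup S \<le> 1\<close> by simp
    qed
  qed
qed

text \<open>Induction on the index set: the old functions are merged into one weighted sum, which
  leaves an alternative between two functions.\<close>

lemma alternative_weights:
  fixes g :: "'i \<Rightarrow> 'b \<Rightarrow> real"
  assumes "finite I" "I \<noteq> {}" "convexlike_on T I g"
    and "\<And>x. x \<in> T \<Longrightarrow> \<exists>i\<in>I. g i x \<ge> 0"
  shows "\<exists>p. (\<forall>i\<in>I. p i \<ge> 0) \<and> sum p I = 1 \<and> (\<forall>x\<in>T. (\<Sum>i\<in>I. p i * g i x) \<ge> 0)"
  using assms
proof (induction I arbitrary: T rule: finite_ne_induct)
  case (singleton j)
  then show ?case by (intro exI[of _ "\<lambda>_. 1"]) auto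
next
  case (insert j I)
  \<comment> \<open>Where \<open>g j\<close> is negative, one of the other functions must be
    nonnegative, so the induction hypothesis applies there. Convexlikeness survives because whatever
    lies below a combination of negative values is negative.\<close>
  define T' where "T' = {x \<in> T. g j x < 0}"
  have "convexlike_on T' I g"
    unfolding convexlike_on_def
  proof (intro ballI)
    fix x y t assume x: "x \<in> T'" and y: "y \<in> T'" and t: "t \<in> {0..1::real}"
    then obtain z where z: "z \<in> T" "\<And>i. i \<in> insert j I \<Longrightarrow> g i z \<le> t * g i x + (1 - t) * g i y"
      using convexlike_onD[OF insert.prems(1), of x y t] by (auto simp: T'_def)
    have "t * g j x + (1 - t) * g j y < 0"
      using convex_bound_lt[of "g j x" 0 "g j y" t "1 - t"] x y t by (simp add: T'_def)
    then have "z \<in> T'" using z by (force simp: T'_def)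
    then show "\<exists>z\<in>T'. \<forall>i\<in>I. g i z \<le> t * g i x + (1 - t) * g i y" using z by blast
  qed
  moreover have "\<exists>i\<in>I. g i x \<ge> 0" if "x \<in> T'" for x
    using insert.prems(2)[of x] that by (force simp: T'_def)
  ultimately obtain p where p: "\<And>i. i \<in> I \<Longrightarrow> p i \<ge> 0" "sum p I = 1"
    "\<And>x. x \<in> T' \<Longrightarrow> (\<Sum>i\<in>I. p i * g i x) \<ge> 0"
    using insert.IH[of T'] by metis
  \<comment> \<open>By the choice of \<open>p\<close>, \<open>h\<close> is nonnegative wherever
    \<open>g j\<close> is negative. This is the alternative between \<open>h\<close> and
    \<open>g j\<close> on all of \<open>T\<close>.\<close>
  define h where "h x = (\<Sum>i\<in>I. p i * g i x)" for x
  have "\<exists>z\<in>T. h z \<le> t * h x + (1 - t) * h y \<and> g j z \<le> t * g j x + (1 - t) * g j y"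
    if xyt: "x \<in> T" "y \<in> T" "0 \<le> t" "t \<le> 1" for x y t
  proof -
    obtain z where z: "z \<in> T" "\<And>i. i \<in> insert j I \<Longrightarrow> g i z \<le> t * g i x + (1 - t) * g i y"
      using convexlike_onD[OF insert.prems(1) xyt] by blast
    have "h z \<le> (\<Sum>i\<in>I. p i * (t * g i x + (1 - t) * g i y))"
      unfolding h_def using z p by (intro sum_mono mult_left_mono) auto
    also have "\<dots> = t * h x + (1 - t) * h y"
      unfolding h_def sum_distrib_left sum.distrib[symmetric]
      by (intro sum.cong) (auto simp: algebra_simps)
    finally show ?thesis using z by auto
  qed
  moreover have "h x \<ge> 0 \<or> g j x \<ge> 0" if "x \<in> T" for x
    using p(3)[of x] that by (force simp: T'_def h_def)
  ultimately obtain l where l: "0 \<le> l" "l \<le> 1" "\<And>x. x \<in> T \<Longrightarrow> l * h x + (1 - l) * g j x \<ge> 0"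
    using alternative_two[of T h "g j"] by blast
  define p' where "p' i = (if i = j then 1 - l else l * p i)" for i
  have on_I: "(\<Sum>i\<in>I. p' i * c i) = l * (\<Sum>i\<in>I. p i * c i)" for c :: "'i \<Rightarrow> real"
    unfolding sum_distrib_left p'_def using insert.hyps by (intro sum.cong) auto
  have "sum p' I = l" using on_I[of "\<lambda>_. 1"] p(2) by simp
  then have "sum p' (insert j I) = 1" using insert.hyps by (simp add: p'_def)
  moreover have "(\<Sum>i\<in>insert j I. p' i * g i x) \<ge> 0" if "x \<in> T" for x
    using l(3)[OF that] insert.hyps on_I[of "\<lambda>i. g i x"] by (simp add: h_def p'_def[of j] add.commute)
  ultimately show ?case using p(1) l(1,2)
    by (intro exI[of _ p']) (auto simp: p'_def)
qed

lemma pmf_of_weights: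
  assumes "finite I" "\<And>i. i \<in> I \<Longrightarrow> p i \<ge> (0::real)" "sum p I = 1"
  obtains P where "set_pmf P \<subseteq> I" "\<And>f. measure_pmf.expectation P f = (\<Sum>i\<in>I. p i * f i)"
proof -
  \<comment> \<open>\<open>embed_pmf\<close> needs a mass function on the whole type, hence the
    extension by zero.\<close>
  define p' where "p' i = (if i \<in> I then p i else 0)" for i
  have nn: "p' i \<ge> 0" for i using assms(2) by (simp add: p'_def)
  have "(\<integral>\<^sup>+ i. ennreal (p' i) \<partial>count_space UNIV) = (\<Sum>i\<in>I. ennreal (p' i))"
    using assms(1) by (intro nn_integral_count_space') (auto simp: p'_def)
  also have "\<dots> = ennreal (sum p' I)" using nn by (simp add: sum_ennreal)
  also have "sum p' I = 1" using assms(3) by (simp add: p'_def)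
  finally have 1: "(\<integral>\<^sup>+ i. ennreal (p' i) \<partial>count_space UNIV) = 1" by simp
  define P where "P = embed_pmf p'"
  have pmf: "pmf P i = p' i" for i unfolding P_def using nn 1 by (rule pmf_embed_pmf)
  have sub: "set_pmf P \<subseteq> I" by (auto simp: set_pmf_iff pmf p'_def split: if_splits)
  show thesis
  proof (rule that[OF sub])
    fix f :: "'a \<Rightarrow> real"
    have "measure_pmf.expectation P f = (\<Sum>i\<in>I. f i * pmf P i)"
      using sub by (intro integral_measure_pmf_real[OF assms(1)]) auto
    then show "measure_pmf.expectation P f = (\<Sum>i\<in>I. p i * f i)"
      by (simp add: pmf p'_def mult.commute)
  qed
qed

lemma alternative_pmf:
  fixes g :: "'i \<Rightarrow> 'b \<Rightarrow> real"
  assumes "finite I" "I \<noteq> {}" "convexlike_on T I g"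
    and "\<And>x. x \<in> T \<Longrightarrow> \<exists>i\<in>I. g i x \<ge> 0"
  obtains P where "set_pmf P \<subseteq> I" "\<And>x. x \<in> T \<Longrightarrow> measure_pmf.expectation P (\<lambda>i. g i x) \<ge> 0"
proof -
  obtain p where p: "\<And>i. i \<in> I \<Longrightarrow> p i \<ge> 0" "sum p I = 1" "\<And>x. x \<in> T \<Longrightarrow> (\<Sum>i\<in>I. p i * g i x) \<ge> 0"
    using alternative_weights[OF assms] by auto
  obtain P where P: "set_pmf P \<subseteq> I" "\<And>f. measure_pmf.expectation P f = (\<Sum>i\<in>I. p i * f i)"
    using pmf_of_weights[OF assms(1) p(1,2)] by blast
  show thesis by (rule that[OF P(1)]) (simp add: P(2) p(3))
qed

subsection \<open>Duality between separation and advantage\<close>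

lemma square_expectation_convex:
  fixes f g :: "'a \<Rightarrow> real"
  assumes "finite (set_pmf Q)" "0 \<le> t" "t \<le> 1"
  shows "measure_pmf.expectation Q (\<lambda>x. (t * f x + (1 - t) * g x)\<^sup>2) \<le>
    t * measure_pmf.expectation Q (\<lambda>x. (f x)\<^sup>2) + (1 - t) * measure_pmf.expectation Q (\<lambda>x. (g x)\<^sup>2)"
proof -
  have "(t * a + (1 - t) * b)\<^sup>2 \<le> t * a\<^sup>2 + (1 - t) * b\<^sup>2" for a b :: real
  proof -
    have "t * a\<^sup>2 + (1 - t) * b\<^sup>2 - (t * a + (1 - t) * b)\<^sup>2 = t * (1 - t) * (a - b)\<^sup>2"
      by (simp add: power2_eq_square algebra_simps)
    moreover have "t * (1 - t) * (a - b)\<^sup>2 \<ge> 0" using assms by simp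
    ultimately show ?thesis by linarith
  qed
  then have "measure_pmf.expectation Q (\<lambda>x. (t * f x + (1 - t) * g x)\<^sup>2) \<le>
      measure_pmf.expectation Q (\<lambda>x. t * (f x)\<^sup>2 + (1 - t) * (g x)\<^sup>2)"
    using assms(1) by (intro integral_mono integrable_measure_pmf_finite) auto
  also have "\<dots> = t * measure_pmf.expectation Q (\<lambda>x. (f x)\<^sup>2) + (1 - t) * measure_pmf.expectation Q (\<lambda>x. (g x)\<^sup>2)"
    using assms(1) by (simp add: integrable_measure_pmf_finite)
  finally show ?thesis .
qed

lemma dual_pmf:
  fixes W :: "('a \<Rightarrow> real) set"
  assumes Q: "finite (set_pmf Q)" and R: "finite R" "R \<noteq> {}" and s: "s > 0"
    and add: "\<And>f g. f \<in> W \<Longrightarrow> g \<in> W \<Longrightarrow> (\<lambda>x. f x + g x) \<in> W"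
    and scale: "\<And>c f. f \<in> W \<Longrightarrow> (\<lambda>x. c * f x) \<in> W"
    and nosep: "\<And>f. f \<in> W \<Longrightarrow> (\<And>x. x \<in> R \<Longrightarrow> f x \<ge> 1) \<Longrightarrow> measure_pmf.expectation Q (\<lambda>x. (f x)\<^sup>2) \<ge> s"
  obtains P where "set_pmf P \<subseteq> R"
    "\<And>f. f \<in> W \<Longrightarrow> sqrt s * measure_pmf.expectation P f \<le> sqrt (measure_pmf.expectation Q (\<lambda>x. (f x)\<^sup>2))"
proof -
  define e where "e f = measure_pmf.expectation Q (\<lambda>x. (f x)\<^sup>2)" for f :: "'a \<Rightarrow> real"
  \<comment> \<open>The strict inequality matters: by \<open>nosep\<close>, no member of
    \<open>T\<close> is at least 1 on all of \<open>R\<close>, so at some \<open>x\<close> in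
    \<open>R\<close> the value \<open>1 - f x\<close> is nonnegative.\<close>
  define T where "T = {f \<in> W. e f < s}"
  have "convexlike_on T R (\<lambda>x f. 1 - f x)"
    unfolding convexlike_on_def
  proof (intro ballI)
    fix f g t assume f: "f \<in> T" and g: "g \<in> T" and t: "t \<in> {0..1::real}"
    define h where "h x = t * f x + (1 - t) * g x" for x
    have "e h \<le> t * e f + (1 - t) * e g"
      unfolding e_def h_def using square_expectation_convex[OF Q] t by simp
    also have "\<dots> < s" using convex_bound_lt[of "e f" s "e g" t "1 - t"] f g t by (simp add: T_def)
    finally have "e h < s" .
    moreover have "h \<in> W" using f g add[OF scale scale] by (simp add: T_def h_def[abs_def])
    ultimately have "h \<in> T" by (simp add: T_def)
    then show "\<exists>z\<in>T. \<forall>x\<in>R. 1 - z x \<le> t * (1 - f x) + (1 - t) * (1 - g x)"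
      by (intro bexI[of _ h]) (auto simp: h_def algebra_simps)
  qed
  moreover have "\<exists>x\<in>R. 1 - f x \<ge> 0" if "f \<in> T" for f
    using nosep[of f] that by (force simp: T_def e_def)
  ultimately obtain P where P: "set_pmf P \<subseteq> R"
    "\<And>f. f \<in> T \<Longrightarrow> measure_pmf.expectation P (\<lambda>x. 1 - f x) \<ge> 0"
    using alternative_pmf[OF R, of T "\<lambda>x f. 1 - f x"] by blast
  have fin: "finite (set_pmf P)" using P(1) R(1) by (rule finite_subset)
  have le1: "measure_pmf.expectation P f \<le> 1" if "f \<in> T" for f
    using P(2)[OF that] fin by (simp add: integrable_measure_pmf_finite)
  show thesis
  proof (rule that[OF P(1)], rule ccontr)
    fix f assume f: "f \<in> W"
    define p where "p = measure_pmf.expectation P f"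
    assume "\<not> sqrt s * measure_pmf.expectation P f \<le> sqrt (measure_pmf.expectation Q (\<lambda>x. (f x)\<^sup>2))"
    \<comment> \<open>Dividing by \<open>m\<close> rather than by \<open>sqrt (e f)\<close> also
      covers \<open>e f = 0\<close>. The rescaled function has second moment strictly below
      \<open>s\<close>, yet its mean under \<open>P\<close> exceeds 1.\<close>
    then obtain m where m: "sqrt (e f) < m" "m < sqrt s * p"
      using dense[of "sqrt (e f)" "sqrt s * p"] by (auto simp: p_def e_def)
    have "e f \<ge> 0" unfolding e_def by simp
    then have m0: "m > 0" using m(1) real_sqrt_ge_zero[of "e f"] by linarith
    then have "e f < m\<^sup>2" using m(1) real_less_rsqrt real_sqrt_less_iff[of "e f" "m\<^sup>2"] by simp
    define g where "g x = sqrt s / m * f x" for x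
    have "e g = (sqrt s / m)\<^sup>2 * e f" unfolding e_def g_def power_mult_distrib by simp
    also have "\<dots> = s * e f / m\<^sup>2" using s by (simp add: power_divide)
    also have "\<dots> < s" using \<open>e f < m\<^sup>2\<close> s m0 by (simp add: divide_less_eq)
    finally have "e g < s" .
    moreover have "g \<in> W" unfolding g_def by (rule scale[OF f])
    ultimately have "g \<in> T" by (simp add: T_def)
    then have "measure_pmf.expectation P g \<le> 1" by (rule le1)
    also have "measure_pmf.expectation P g = sqrt s / m * p" unfolding g_def p_def by simp
    finally show False using m m0 by (simp add: divide_le_eq)
  qed
qed

subsection \<open>Polynomial functions\<close>

text \<open>Coefficients can cancel in a sum, so evaluations are compared over a common finite set
  of exponents instead of the exact supports.\<close>

lemma peval_superset:
  assumes "finite K" "Poly_Mapping.keys p \<subseteq> K"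
  shows "peval p x = (\<Sum>m\<in>K. Poly_Mapping.lookup p m *
    (\<Prod>i\<in>Poly_Mapping.keys m. x i ^ Poly_Mapping.lookup m i))"
  unfolding peval_def using assms by (intro sum.mono_neutral_left) (auto simp: in_keys_iff)

lemma peval_add: "peval (p + q) x = peval p x + peval q x"
proof -
  let ?K = "Poly_Mapping.keys p \<union> Poly_Mapping.keys q"
  have "Poly_Mapping.keys (p + q) \<subseteq> ?K" by (rule Poly_Mapping.keys_add)
  then show ?thesis
    by (simp add: peval_superset[of ?K] lookup_add distrib_right sum.distrib)
qed

lemma peval_scale: "peval (Poly_Mapping.map ((*) c) p) x = c * peval p x"
proof -
  \<comment> \<open>Only an inclusion: for \<open>c = 0\<close> every key disappears.\<close>
  have "Poly_Mapping.keys (Poly_Mapping.map ((*) c) p) \<subseteq> Poly_Mapping.keys p"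
    by (auto simp: in_keys_iff map.rep_eq when_def)
  then have "peval (Poly_Mapping.map ((*) c) p) x =
      (\<Sum>m\<in>Poly_Mapping.keys p. Poly_Mapping.lookup (Poly_Mapping.map ((*) c) p) m *
        (\<Prod>i\<in>Poly_Mapping.keys m. x i ^ Poly_Mapping.lookup m i))"
    by (intro peval_superset) auto
  also have "\<dots> = c * peval p x"
    unfolding peval_def sum_distrib_left
    by (intro sum.cong) (auto simp: map.rep_eq when_def in_keys_iff)
  finally show ?thesis .
qed

lemma peval_const: "peval (Poly_Mapping.single 0 c) x = c"
  by (simp add: peval_def)

lemma const_in_polys_le: "Poly_Mapping.single 0 c \<in> polys_le N D"
  by (simp add: polys_le_def monom_deg_def)

lemma add_in_polys_le: "p \<in> polys_le N D \<Longrightarrow> q \<in> polys_le N D \<Longrightarrow> p + q \<in> polys_le N D"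
  unfolding polys_le_def using Poly_Mapping.keys_add[of p q] by blast

lemma scale_in_polys_le: "p \<in> polys_le N D \<Longrightarrow> Poly_Mapping.map ((*) c) p \<in> polys_le N D"
  by (auto simp: polys_le_def in_keys_iff map.rep_eq when_def)

text \<open>Together with closure under scaling, this provides the linear structure that
  \<open>dual_pmf\<close> asks for.\<close>

lemma poly_functions_add:
  assumes "f \<in> peval ` polys_le N D" "g \<in> peval ` polys_le N D"
  shows "(\<lambda>x. f x + g x) \<in> peval ` polys_le N D"
proof -
  obtain p q where "p \<in> polys_le N D" "q \<in> polys_le N D" "f = peval p" "g = peval q"
    using assms by blast
  then show ?thesis by (intro image_eqI[of _ _ "p + q"]) (auto simp: peval_add add_in_polys_le)
qed

lemma poly_functions_scale:
  assumes "f \<in> peval ` polys_le N D"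
  shows "(\<lambda>x. c * f x) \<in> peval ` polys_le N D"
proof -
  obtain p where "p \<in> polys_le N D" "f = peval p" using assms by blast
  then show ?thesis
    by (intro image_eqI[of _ _ "Poly_Mapping.map ((*) c) p"]) (auto simp: peval_scale scale_in_polys_le)
qed

lemma poly_functions_const: "(\<lambda>_. c) \<in> peval ` polys_le N D"
  by (intro image_eqI[of _ _ "Poly_Mapping.single 0 c"]) (auto simp: peval_const const_in_polys_le)

section \<open>Bounds on the advantage, in terms of polynomial functions\<close>

lemma Adv_alt: "Adv N D P Q = (SUP f\<in>peval ` polys_le N D.
     ereal (measure_pmf.expectation P f) / ereal (sqrt (measure_pmf.expectation Q (\<lambda>x. (f x)\<^sup>2))))"
  unfolding Adv_def by (simp only: image_image)

lemma Adv_ge_1: "Adv N D P Q \<ge> 1"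
  unfolding Adv_alt by (rule SUP_upper2[OF poly_functions_const[of 1]]) simp

lemma Adv_leD:
  assumes "Adv N D P Q \<le> ereal B" "f \<in> peval ` polys_le N D"
  shows "measure_pmf.expectation P f \<le> B * sqrt (measure_pmf.expectation Q (\<lambda>x. (f x)\<^sup>2))"
proof -
  define e where "e = sqrt (measure_pmf.expectation Q (\<lambda>x. (f x)\<^sup>2))"
  define p where "p = measure_pmf.expectation P f"
  have "e \<ge> 0" by (simp add: e_def)
  have "ereal p / ereal e \<le> ereal B"
    unfolding e_def p_def using assms SUP_le_iff[THEN iffD1] unfolding Adv_alt by blast
  \<comment> \<open>If \<open>e = 0\<close>, a positive \<open>p\<close> would make the quotient
    infinite, so the finite bound forces \<open>p \<le> 0\<close>.\<close>
  then have "p \<le> B * e"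
    using \<open>e \<ge> 0\<close> by (cases "e = 0"; cases p "0::real" rule: linorder_cases)
      (auto simp: divide_ereal_def divide_simps split: if_splits)
  then show ?thesis by (simp add: e_def p_def)
qed

text \<open>The product form also controls functions with vanishing second moment: their mean under
  \<open>P\<close> is at most 0. The sign of \<open>B\<close> enters through the quotient of 0 by 0,
  which is 0.\<close>

lemma Adv_leI:
  assumes "B \<ge> 0"
    and le: "\<And>f. f \<in> peval ` polys_le N D \<Longrightarrow>
      measure_pmf.expectation P f \<le> B * sqrt (measure_pmf.expectation Q (\<lambda>x. (f x)\<^sup>2))"
  shows "Adv N D P Q \<le> ereal B"
  unfolding Adv_alt
proof (rule SUP_least)
  fix f assume f: "f \<in> peval ` polys_le N D"
  define e where "e = sqrt (measure_pmf.expectation Q (\<lambda>x. (f x)\<^sup>2))"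
  define p where "p = measure_pmf.expectation P f"
  have "e \<ge> 0" by (simp add: e_def)
  moreover have "p \<le> B * e" unfolding e_def p_def by (rule le[OF f])
  ultimately have "ereal p / ereal e \<le> ereal B"
    using assms(1) by (cases "e = 0"; cases p "0::real" rule: linorder_cases)
      (auto simp: divide_ereal_def divide_simps split: if_splits)
  then show "ereal (measure_pmf.expectation P f) /
      ereal (sqrt (measure_pmf.expectation Q (\<lambda>x. (f x)\<^sup>2))) \<le> ereal B"
    by (simp add: e_def p_def)
qed

subsection \<open>The two quantitative dualities\<close>

lemma expectation_ge_1:
  fixes f :: "'a \<Rightarrow> real"
  assumes "finite R" "set_pmf P \<subseteq> R" "\<And>x. x \<in> R \<Longrightarrow> f x \<ge> 1"
  shows "measure_pmf.expectation P f \<ge> 1"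
proof -
  have "finite (set_pmf P)" using assms finite_subset by blast
  then have "measure_pmf.expectation P (\<lambda>_. 1) \<le> measure_pmf.expectation P f"
    using assms by (intro integral_mono_AE integrable_measure_pmf_finite) (auto simp: AE_measure_pmf_iff)
  then show ?thesis by simp
qed

text \<open>The function \<open>f\<close> itself is tested in the supremum: its mean under
  \<open>P\<close> is at least 1. The squared form makes no reference to the sign of
  \<open>B\<close>.\<close>

lemma strong_lower_bound:
  assumes "finite R" "set_pmf P \<subseteq> R" "f \<in> peval ` polys_le N D"
    and "\<And>x. x \<in> R \<Longrightarrow> f x \<ge> 1" "Adv N D P Q \<le> ereal B"
  shows "1 \<le> B\<^sup>2 * measure_pmf.expectation Q (\<lambda>x. (f x)\<^sup>2)"
proof -
  have "1 \<le> B * sqrt (measure_pmf.expectation Q (\<lambda>x. (f x)\<^sup>2))"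
    using Adv_leD[OF assms(5,3)] expectation_ge_1[of R P f, OF assms(1,2,4)] by linarith
  then have "1\<^sup>2 \<le> (B * sqrt (measure_pmf.expectation Q (\<lambda>x. (f x)\<^sup>2)))\<^sup>2"
    by (intro power_mono) auto
  then show ?thesis by (simp add: power_mult_distrib)
qed

lemma strong_dual:
  assumes "finite (set_pmf Q)" "finite R" "s > 0"
    and nosep: "\<And>f. f \<in> peval ` polys_le N D \<Longrightarrow> (\<And>x. x \<in> R \<Longrightarrow> f x \<ge> 1) \<Longrightarrow>
      measure_pmf.expectation Q (\<lambda>x. (f x)\<^sup>2) \<ge> s"
  obtains P where "set_pmf P \<subseteq> R" "Adv N D P Q \<le> ereal (1 / sqrt s)"
proof -
  \<comment> \<open>On an empty \<open>R\<close> the zero polynomial would be admissible, with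
    second moment below \<open>s\<close>.\<close>
  have "R \<noteq> {}" using nosep[OF poly_functions_const[of 0]] \<open>s > 0\<close> by auto
  obtain P where P: "set_pmf P \<subseteq> R" "\<And>f. f \<in> peval ` polys_le N D \<Longrightarrow>
      sqrt s * measure_pmf.expectation P f \<le> sqrt (measure_pmf.expectation Q (\<lambda>x. (f x)\<^sup>2))"
    using dual_pmf[OF assms(1,2) \<open>R \<noteq> {}\<close> assms(3) poly_functions_add poly_functions_scale nosep]
    by metis
  have "Adv N D P Q \<le> ereal (1 / sqrt s)"
    using P(2) \<open>s > 0\<close> by (intro Adv_leI) (auto simp: field_simps)
  with P(1) that show thesis by blast
qed

text \<open>For mean-zero \<open>f\<close>, the function \<open>1 + t f\<close> has mean at least
  \<open>1 + t\<close> under \<open>P\<close> and second moment at most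
  \<open>1 + t\<^sup>2 K\<close> under \<open>Q\<close>, for every \<open>t \<ge> 0\<close>.\<close>

lemma weak_lower_bound:
  assumes R: "finite R" "set_pmf P \<subseteq> R" and Q: "finite (set_pmf Q)" and f: "f \<in> peval ` polys_le N D"
    and ge: "\<And>x. x \<in> R \<Longrightarrow> f x \<ge> 1" and mean: "measure_pmf.expectation Q f = 0"
    and K: "measure_pmf.expectation Q (\<lambda>x. (f x)\<^sup>2) \<le> K" "K > 0"
  shows "ereal (sqrt (1 + 1 / K)) \<le> Adv N D P Q"
proof (rule ccontr)
  assume "\<not> ?thesis"
  \<comment> \<open>The advantage is at least 1 and below a real number, hence itself real.\<close>
  then obtain B where B: "Adv N D P Q \<le> ereal B" "B < sqrt (1 + 1 / K)"
    using Adv_ge_1[of N D P Q] by (cases "Adv N D P Q") (auto simp: not_le)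
  have "ereal 1 \<le> ereal B" using order_trans[OF Adv_ge_1 B(1)] by (simp add: one_ereal_def)
  then have "B \<ge> 1" by simp
  \<comment> \<open>the slope \<open>1 / K\<close> maximises \<open>(1 + t) / sqrt (1 + t\<^sup>2 K)\<close> over \<open>t\<close>\<close>
  define g where "g x = 1 + 1 / K * f x" for x
  have g: "g \<in> peval ` polys_le N D"
    unfolding g_def by (rule poly_functions_add[OF poly_functions_const poly_functions_scale[OF f]])
  have fin: "finite (set_pmf P)" using R finite_subset by blast
  have "1 + 1 / K \<le> 1 + 1 / K * measure_pmf.expectation P f"
    using expectation_ge_1[of R P f, OF R ge] K(2) by (simp add: divide_simps)
  also have "\<dots> = measure_pmf.expectation P g"
    unfolding g_def using fin by (simp add: integrable_measure_pmf_finite)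
  also have "\<dots> \<le> B * sqrt (measure_pmf.expectation Q (\<lambda>x. (g x)\<^sup>2))" by (rule Adv_leD[OF B(1) g])
  also have "measure_pmf.expectation Q (\<lambda>x. (g x)\<^sup>2) =
      measure_pmf.expectation Q (\<lambda>x. 1 + (2 / K * f x + (1 / K)\<^sup>2 * (f x)\<^sup>2))"
    by (intro arg_cong[where f = "measure_pmf.expectation Q"]) (auto simp: g_def power2_eq_square algebra_simps)
  also have "\<dots> = 1 + (1 / K)\<^sup>2 * measure_pmf.expectation Q (\<lambda>x. (f x)\<^sup>2)"
    using Q mean by (simp add: integrable_measure_pmf_finite)
  also have "B * sqrt \<dots> \<le> B * sqrt (1 + 1 / K)"
  proof -
    have "(1 / K)\<^sup>2 * measure_pmf.expectation Q (\<lambda>x. (f x)\<^sup>2) \<le> (1 / K)\<^sup>2 * K"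
      using K by (intro mult_left_mono) auto
    then show ?thesis using K(2) \<open>B \<ge> 1\<close> by (intro mult_left_mono) (auto simp: power2_eq_square)
  qed
  also have "\<dots> < sqrt (1 + 1 / K) * sqrt (1 + 1 / K)"
    using B(2) K(2) by (intro mult_strict_right_mono) (auto intro: add_pos_pos)
  also have "\<dots> = 1 + 1 / K" using K(2) by simp
  finally show False by simp
qed

text \<open>Constants and mean-zero functions are orthogonal under \<open>Q\<close>. Duality bounds
  the mean-zero part, the constant part has the same mean under \<open>P\<close> and
  \<open>Q\<close>, and Cauchy-Schwarz in the plane recombines them.\<close>

lemma weak_dual:
  assumes Q: "finite (set_pmf Q)" and R: "finite R" and "K > 0"
    and nosep: "\<And>f. f \<in> peval ` polys_le N D \<Longrightarrow> (\<And>x. x \<in> R \<Longrightarrow> f x \<ge> 1) \<Longrightarrow>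
      measure_pmf.expectation Q f = 0 \<Longrightarrow> measure_pmf.expectation Q (\<lambda>x. (f x)\<^sup>2) \<ge> K"
  obtains P where "set_pmf P \<subseteq> R" "Adv N D P Q \<le> ereal (sqrt (1 + 1 / K))"
proof -
  define W where "W = {f \<in> peval ` polys_le N D. measure_pmf.expectation Q f = 0}"
  have "R \<noteq> {}" using nosep[OF poly_functions_const[of 0]] \<open>K > 0\<close> by auto
  have add: "(\<lambda>x. f x + g x) \<in> W" if "f \<in> W" "g \<in> W" for f g
    using that Q poly_functions_add[of f N D g] by (simp add: W_def integrable_measure_pmf_finite)
  have scale: "(\<lambda>x. c * f x) \<in> W" if "f \<in> W" for c f
    using that poly_functions_scale[of f N D c] by (simp add: W_def)
  have nosep': "measure_pmf.expectation Q (\<lambda>x. (f x)\<^sup>2) \<ge> K" if "f \<in> W" "\<And>x. x \<in> R \<Longrightarrow> f x \<ge> 1" for f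
    using nosep that by (simp add: W_def)
  obtain P where P: "set_pmf P \<subseteq> R"
    "\<And>f. f \<in> W \<Longrightarrow> sqrt K * measure_pmf.expectation P f \<le> sqrt (measure_pmf.expectation Q (\<lambda>x. (f x)\<^sup>2))"
    using dual_pmf[OF Q R \<open>R \<noteq> {}\<close> \<open>K > 0\<close> add scale nosep'] by metis
  have fin: "finite (set_pmf P)" using P(1) R by (rule finite_subset)
  have "Adv N D P Q \<le> ereal (sqrt (1 + 1 / K))"
  proof (rule Adv_leI)
    show "0 \<le> sqrt (1 + 1 / K)" using \<open>K > 0\<close> by simp
    fix f assume f: "f \<in> peval ` polys_le N D"
    define a where "a = measure_pmf.expectation Q f"
    define f0 where "f0 x = f x + (- a)" for x
    have f0: "f0 \<in> W"
      using poly_functions_add[OF f poly_functions_const[of "- a"]] Q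
      by (simp add: W_def f0_def[abs_def] a_def integrable_measure_pmf_finite)
    define b where "b = sqrt (measure_pmf.expectation Q (\<lambda>x. (f0 x)\<^sup>2))"
    \<comment> \<open>Pythagoras: the cross term vanishes because \<open>f0\<close> has mean zero
      under \<open>Q\<close>.\<close>
    have "measure_pmf.expectation Q (\<lambda>x. (f x)\<^sup>2) =
        measure_pmf.expectation Q (\<lambda>x. a\<^sup>2 + (2 * a * f0 x + (f0 x)\<^sup>2))"
      by (intro arg_cong[where f = "measure_pmf.expectation Q"])
        (auto simp: f0_def power2_eq_square algebra_simps)
    also have "\<dots> = a\<^sup>2 + b\<^sup>2"
      using Q f0 by (simp add: integrable_measure_pmf_finite W_def b_def)
    finally have pyth: "measure_pmf.expectation Q (\<lambda>x. (f x)\<^sup>2) = a\<^sup>2 + b\<^sup>2" .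
    have "measure_pmf.expectation P f = a + measure_pmf.expectation P f0"
      unfolding f0_def using fin by (simp add: integrable_measure_pmf_finite)
    also have "\<dots> \<le> 1 * a + 1 / sqrt K * b"
      using P(2)[OF f0] \<open>K > 0\<close> by (simp add: b_def field_simps)
    \<comment> \<open>Cauchy-Schwarz for the vectors \<open>(1, 1 / sqrt K)\<close> and
      \<open>(a, b)\<close>; the defect in it is a single square.\<close>
    also have "\<dots> \<le> sqrt ((1\<^sup>2 + (1 / sqrt K)\<^sup>2) * (a\<^sup>2 + b\<^sup>2))"
    proof (rule real_le_rsqrt)
      have "(1\<^sup>2 + c\<^sup>2) * (a\<^sup>2 + b\<^sup>2) - (1 * a + c * b)\<^sup>2 = (b - c * a)\<^sup>2" for c
        by (simp add: power2_eq_square algebra_simps)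
      then show "(1 * a + 1 / sqrt K * b)\<^sup>2 \<le> (1\<^sup>2 + (1 / sqrt K)\<^sup>2) * (a\<^sup>2 + b\<^sup>2)"
        by (metis zero_le_power2 diff_ge_0_iff_ge)
    qed
    also have "\<dots> = sqrt (1 + 1 / K) * sqrt (measure_pmf.expectation Q (\<lambda>x. (f x)\<^sup>2))"
      using \<open>K > 0\<close> by (simp add: pyth real_sqrt_mult power_divide)
    finally show "measure_pmf.expectation P f \<le>
        sqrt (1 + 1 / K) * sqrt (measure_pmf.expectation Q (\<lambda>x. (f x)\<^sup>2))" .
  qed
  with P(1) that show thesis by blast
qed

subsection \<open>Passage to sequences\<close>

text \<open>The property may vary with \<open>k\<close>: the strong case uses a fixed one, the weak
  case a threshold growing with \<open>k\<close>, which yields a diagonal subsequence.\<close>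

lemma strict_mono_choice:
  fixes A :: "nat \<Rightarrow> nat \<Rightarrow> bool"
  assumes "\<And>k. \<exists>\<^sub>F n in sequentially. A k n"
  obtains r where "strict_mono r" "\<And>k. A k (r k)"
proof -
  have "\<exists>n>m. A k n" for k m
    using assms[of k] unfolding frequently_sequentially by (meson Suc_le_lessD)
  then have "\<exists>r. \<forall>k. A k (r k) \<and> r k < r (Suc k)"
    by (intro dependent_nat_choice) blast+
  then obtain r where "\<And>k. A k (r k)" "\<And>k. r k < r (Suc k)" by blast
  then show thesis by (intro that[of r]) (simp_all add: strict_mono_Suc_iff)
qed

text \<open>A bounded advantage along a subsequence keeps the second moments of a separating
  sequence away from zero there. Conversely, without separation the least second moment does not
  tend to zero, so duality applies at infinitely many \<open>n\<close> with one common
  constant.\<close>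

lemma strong_equivalence:
  fixes N D :: "nat \<Rightarrow> nat"
    and Q :: "nat \<Rightarrow> (nat \<Rightarrow> real) pmf"
    and R :: "nat \<Rightarrow> (nat \<Rightarrow> real) set"
  assumes Q: "\<And>n. finite (set_pmf (Q n))" and R: "\<And>n. finite (R n)"
  shows "(\<nexists>f. (\<forall>n. f n \<in> polys_le (N n) (D n)) \<and> strongly_separates f Q R) \<longleftrightarrow>
      (\<exists>(r :: nat \<Rightarrow> nat) (P :: nat \<Rightarrow> (nat \<Rightarrow> real) pmf).
         strict_mono r \<and> (\<forall>k. set_pmf (P k) \<subseteq> R (r k)) \<and>
         (\<exists>C::real. \<forall>\<^sub>F k in sequentially. Adv (N (r k)) (D (r k)) (P k) (Q (r k)) \<le> ereal C))"
    (is "?nosep \<longleftrightarrow> ?adv")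
proof
  assume ?adv
  then obtain r P C where r: "strict_mono r" and P: "\<And>k. set_pmf (P k) \<subseteq> R (r k)"
    and C: "\<forall>\<^sub>F k in sequentially. Adv (N (r k)) (D (r k)) (P k) (Q (r k)) \<le> ereal C"
    by blast
  have r_top: "filterlim r sequentially sequentially" using r by (rule filterlim_subseq)
  show ?nosep
  proof
    assume "\<exists>f. (\<forall>n. f n \<in> polys_le (N n) (D n)) \<and> strongly_separates f Q R"
    then obtain f where f: "\<And>n. f n \<in> polys_le (N n) (D n)"
      and ge: "\<forall>\<^sub>F n in sequentially. \<forall>x\<in>R n. peval (f n) x \<ge> 1"
      and small: "(\<lambda>n. measure_pmf.expectation (Q n) (\<lambda>x. (peval (f n) x)\<^sup>2)) \<in> o(\<lambda>_. 1)"
      unfolding strongly_separates_def by blast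
    have "(\<lambda>n. measure_pmf.expectation (Q n) (\<lambda>x. (peval (f n) x)\<^sup>2)) \<longlonglongrightarrow> 0"
      using smalloD_tendsto[OF small] by simp
    then have "(\<lambda>k. C\<^sup>2 * measure_pmf.expectation (Q (r k)) (\<lambda>x. (peval (f (r k)) x)\<^sup>2)) \<longlonglongrightarrow> C\<^sup>2 * 0"
      by (intro tendsto_intros filterlim_compose[OF _ r_top])
    then have "\<forall>\<^sub>F k in sequentially. C\<^sup>2 * measure_pmf.expectation (Q (r k)) (\<lambda>x. (peval (f (r k)) x)\<^sup>2) < 1"
      by (rule order_tendstoD) simp
    moreover have "\<forall>\<^sub>F k in sequentially. \<forall>x\<in>R (r k). peval (f (r k)) x \<ge> 1"
      using ge r_top by (rule eventually_compose_filterlim)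
    ultimately have "\<forall>\<^sub>F k in sequentially. False"
      using C
    proof eventually_elim
      case (elim k)
      have "1 \<le> C\<^sup>2 * measure_pmf.expectation (Q (r k)) (\<lambda>x. (peval (f (r k)) x)\<^sup>2)"
        by (rule strong_lower_bound[OF R P imageI[OF f] _ elim(3)]) (use elim(2) in blast)
      with elim(1) show ?case by simp
    qed
    then show False by simp
  qed
next
  assume nosep: ?nosep
  define feas where "feas n = {p \<in> polys_le (N n) (D n). \<forall>x\<in>R n. peval p x \<ge> 1}" for n
  define e where "e n p = measure_pmf.expectation (Q n) (\<lambda>x. (peval p x)\<^sup>2)" for n p
  have e_nonneg: "e n p \<ge> 0" for n p by (simp add: e_def)
  define m where "m n = (INF p\<in>feas n. e n p)" for n
  \<comment> \<open>The constant 1 is always feasible, so the infimum \<open>m n\<close> is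
    meaningful.\<close>
  have "Poly_Mapping.single 0 1 \<in> feas n" for n
    unfolding feas_def by (simp only: mem_Collect_eq const_in_polys_le peval_const) simp
  then have feas_ne: "feas n \<noteq> {}" for n by blast
  have bdd: "bdd_below (e n ` feas n)" for n using e_nonneg by (intro bdd_belowI[of _ 0]) auto
  have m_nonneg: "m n \<ge> 0" for n unfolding m_def using feas_ne e_nonneg by (intro cINF_greatest) auto
  \<comment> \<open>Attainment of the infimum is avoided: a minimiser up to
    \<open>1 / (n + 1)\<close> suffices, since this error tends to zero.\<close>
  have "\<exists>p\<in>feas n. e n p < m n + 1 / real (Suc n)" for n
    using cINF_less_iff[OF feas_ne bdd, of n "m n + 1 / real (Suc n)"] by (simp add: m_def)
  then obtain f where f: "\<And>n. f n \<in> feas n" "\<And>n. e n (f n) < m n + 1 / real (Suc n)" by metis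
  have "\<not> m \<longlonglongrightarrow> 0"
  proof
    assume "m \<longlonglongrightarrow> 0"
    then have "(\<lambda>n. m n + 1 / real (Suc n)) \<longlonglongrightarrow> 0 + 0"
      by (intro tendsto_add LIMSEQ_Suc[OF lim_1_over_n])
    then have lim: "(\<lambda>n. m n + 1 / real (Suc n)) \<longlonglongrightarrow> 0" by simp
    have "(\<lambda>n. e n (f n)) \<longlonglongrightarrow> 0"
      by (rule tendsto_sandwich[OF always_eventually always_eventually tendsto_const lim])
        (use f(2) e_nonneg in \<open>auto intro: less_imp_le\<close>)
    then have "(\<lambda>n. e n (f n)) \<in> o(\<lambda>_. 1)"
      by (intro smalloI_tendsto) auto
    then have "strongly_separates f Q R"
      using f(1) by (auto simp: strongly_separates_def feas_def e_def)
    then show False using nosep f(1) by (auto simp: feas_def)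
  qed
  \<comment> \<open>A nonnegative sequence that does not tend to zero stays above some positive
    \<open>s\<close> infinitely often.\<close>
  then obtain s where s: "s > 0" "\<exists>\<^sub>F n in sequentially. m n \<ge> s"
    using m_nonneg by (auto simp: tendsto_iff not_eventually not_less)
  obtain r :: "nat \<Rightarrow> nat" where r: "strict_mono r" "\<And>k. m (r k) \<ge> s"
    by (rule strict_mono_choice[of "\<lambda>_ n. m n \<ge> s", OF s(2)]) blast
  have "\<exists>P. set_pmf P \<subseteq> R (r k) \<and> Adv (N (r k)) (D (r k)) P (Q (r k)) \<le> ereal (1 / sqrt s)" for k
  proof (rule strong_dual[OF Q[of "r k"] R[of "r k"] s(1), of "N (r k)" "D (r k)"])
    fix g assume "g \<in> peval ` polys_le (N (r k)) (D (r k))" and ge: "\<And>x. x \<in> R (r k) \<Longrightarrow> g x \<ge> 1"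
    then obtain p where "p \<in> feas (r k)" "g = peval p" by (auto simp: feas_def)
    then have "m (r k) \<le> measure_pmf.expectation (Q (r k)) (\<lambda>x. (g x)\<^sup>2)"
      using cINF_lower[OF bdd, of p "r k"] by (simp add: m_def e_def)
    then show "s \<le> measure_pmf.expectation (Q (r k)) (\<lambda>x. (g x)\<^sup>2)" using r(2)[of k] by simp
  qed blast
  then obtain P where "\<And>k. set_pmf (P k) \<subseteq> R (r k)"
    "\<And>k. Adv (N (r k)) (D (r k)) (P k) (Q (r k)) \<le> ereal (1 / sqrt s)" by metis
  then show ?adv using r(1)
    by (intro exI[of _ r] exI[of _ P] conjI exI[of _ "1 / sqrt s"]) auto
qed

text \<open>A second moment bound \<open>K\<close> keeps the advantage at or above
  \<open>sqrt (1 + 1 / K)\<close>, away from 1. Conversely, without separation every bound fails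
  infinitely often, and bounds growing along a subsequence push the advantage to 1.\<close>

lemma weak_equivalence:
  fixes N D :: "nat \<Rightarrow> nat"
    and Q :: "nat \<Rightarrow> (nat \<Rightarrow> real) pmf"
    and R :: "nat \<Rightarrow> (nat \<Rightarrow> real) set"
  assumes Q: "\<And>n. finite (set_pmf (Q n))" and R: "\<And>n. finite (R n)"
  shows "(\<nexists>f. (\<forall>n. f n \<in> polys_le (N n) (D n)) \<and> weakly_separates f Q R) \<longleftrightarrow>
      (\<exists>(r :: nat \<Rightarrow> nat) (P :: nat \<Rightarrow> (nat \<Rightarrow> real) pmf).
         strict_mono r \<and> (\<forall>k. set_pmf (P k) \<subseteq> R (r k)) \<and>
         (\<lambda>k. Adv (N (r k)) (D (r k)) (P k) (Q (r k))) \<longlonglongrightarrow> 1)"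
    (is "?nosep \<longleftrightarrow> ?adv")
proof
  assume ?adv
  then obtain r P where r: "strict_mono r" and P: "\<And>k. set_pmf (P k) \<subseteq> R (r k)"
    and lim: "(\<lambda>k. Adv (N (r k)) (D (r k)) (P k) (Q (r k))) \<longlonglongrightarrow> 1"
    by blast
  have r_top: "filterlim r sequentially sequentially" using r by (rule filterlim_subseq)
  show ?nosep
  proof
    assume "\<exists>f. (\<forall>n. f n \<in> polys_le (N n) (D n)) \<and> weakly_separates f Q R"
    then obtain f where f: "\<And>n. f n \<in> polys_le (N n) (D n)"
      and ge: "\<forall>\<^sub>F n in sequentially. \<forall>x\<in>R n. peval (f n) x \<ge> 1"
      and mean: "\<forall>\<^sub>F n in sequentially. measure_pmf.expectation (Q n) (peval (f n)) = 0"
      and "(\<lambda>n. measure_pmf.expectation (Q n) (\<lambda>x. (peval (f n) x)\<^sup>2)) \<in> O(\<lambda>_. 1)"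
      unfolding weakly_separates_def by blast
    then obtain K where K: "K > 0"
      "\<forall>\<^sub>F n in sequentially. measure_pmf.expectation (Q n) (\<lambda>x. (peval (f n) x)\<^sup>2) \<le> K"
      by (auto elim!: landau_o.bigE)
    have "\<forall>\<^sub>F k in sequentially. Adv (N (r k)) (D (r k)) (P k) (Q (r k)) < ereal (sqrt (1 + 1 / K))"
      using lim K(1) by (intro order_tendstoD(2)) (auto simp: one_ereal_def)
    then have "\<forall>\<^sub>F k in sequentially. False"
      using eventually_compose_filterlim[OF ge r_top] eventually_compose_filterlim[OF mean r_top]
        eventually_compose_filterlim[OF K(2) r_top]
    proof eventually_elim
      case (elim k)
      then have "ereal (sqrt (1 + 1 / K)) \<le> Adv (N (r k)) (D (r k)) (P k) (Q (r k))"
        using f K(1) by (intro weak_lower_bound[OF R P Q, where f = "peval (f (r k))"]) auto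
      with elim(1) show ?case by simp
    qed
    then show False by simp
  qed
next
  assume nosep: ?nosep
  \<comment> \<open>A threshold \<open>K\<close> replaces the infimum of the strong case, because a
    mean-zero polynomial that is at least 1 on \<open>R n\<close> may not exist at all.\<close>
  define feas where "feas K n p \<longleftrightarrow> p \<in> polys_le (N n) (D n) \<and> (\<forall>x\<in>R n. peval p x \<ge> 1) \<and>
      measure_pmf.expectation (Q n) (peval p) = 0 \<and>
      measure_pmf.expectation (Q n) (\<lambda>x. (peval p x)\<^sup>2) < K" for K n p
  have "\<exists>\<^sub>F n in sequentially. \<not> (\<exists>p. feas (real (Suc k)) n p)" for k
  proof (rule ccontr)
    assume "\<not> ?thesis"
    then have ev: "\<forall>\<^sub>F n in sequentially. \<exists>p. feas (real (Suc k)) n p"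
      by (simp add: frequently_def)
    \<comment> \<open>The zero polynomial is a default at the indices without a feasible choice. It
      only has to respect the degree bound, as separation is an eventual property.\<close>
    define f where "f n = (if \<exists>p. feas (real (Suc k)) n p then SOME p. feas (real (Suc k)) n p
        else Poly_Mapping.single 0 0)" for n
    have f: "feas (real (Suc k)) n (f n)" if "\<exists>p. feas (real (Suc k)) n p" for n
      using that someI_ex[OF that] by (simp add: f_def)
    have f_ev: "\<forall>\<^sub>F n in sequentially. feas (real (Suc k)) n (f n)"
      using ev by (rule eventually_mono) (rule f)
    have "(\<lambda>n. measure_pmf.expectation (Q n) (\<lambda>x. (peval (f n) x)\<^sup>2)) \<in> O(\<lambda>_. 1)"
      by (rule bigoI[of _ "real (Suc k)"]) (use f_ev in \<open>auto simp: feas_def elim!: eventually_mono\<close>)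
    then have "weakly_separates f Q R"
      using f_ev by (auto simp: weakly_separates_def feas_def elim!: eventually_mono)
    moreover have "f n \<in> polys_le (N n) (D n)" for n
    proof (cases "\<exists>p. feas (real (Suc k)) n p")
      case True
      then show ?thesis using f by (simp add: feas_def)
    next
      case False
      then have "f n = Poly_Mapping.single 0 0" unfolding f_def by (rule if_not_P)
      then show ?thesis using const_in_polys_le[of 0] by simp
    qed
    ultimately show False using nosep by blast
  qed
  \<comment> \<open>Diagonal choice: at index \<open>r k\<close> the threshold \<open>k + 1\<close>
    is infeasible. The shift keeps the threshold positive at \<open>k = 0\<close>.\<close>
  then obtain r where r: "strict_mono r" "\<And>k. \<not> (\<exists>p. feas (real (Suc k)) (r k) p)"
    using strict_mono_choice[of "\<lambda>k n. \<not> (\<exists>p. feas (real (Suc k)) n p)"] by metis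
  have "\<exists>P. set_pmf P \<subseteq> R (r k) \<and>
      Adv (N (r k)) (D (r k)) P (Q (r k)) \<le> ereal (sqrt (1 + 1 / real (Suc k)))" for k
  proof (rule weak_dual[OF Q[of "r k"] R[of "r k"], of "real (Suc k)" "N (r k)" "D (r k)"])
    fix g assume "g \<in> peval ` polys_le (N (r k)) (D (r k))" "\<And>x. x \<in> R (r k) \<Longrightarrow> g x \<ge> 1"
      "measure_pmf.expectation (Q (r k)) g = 0"
    then show "real (Suc k) \<le> measure_pmf.expectation (Q (r k)) (\<lambda>x. (g x)\<^sup>2)"
      using r(2)[of k] by (force simp: feas_def)
  qed (simp, blast)
  then obtain P where P: "\<And>k. set_pmf (P k) \<subseteq> R (r k)"
    "\<And>k. Adv (N (r k)) (D (r k)) (P k) (Q (r k)) \<le> ereal (sqrt (1 + 1 / real (Suc k)))" by metis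
  have "(\<lambda>k. sqrt (1 + 1 / real (Suc k))) \<longlonglongrightarrow> sqrt (1 + 0)"
    by (intro tendsto_intros LIMSEQ_Suc[OF lim_1_over_n])
  then have lim: "(\<lambda>k. ereal (sqrt (1 + 1 / real (Suc k)))) \<longlonglongrightarrow> 1"
    by (simp add: one_ereal_def)
  \<comment> \<open>The constant polynomial 1 supplies the lower bound of the sandwich, the dual
    distributions the upper one.\<close>
  have "(\<lambda>k. Adv (N (r k)) (D (r k)) (P k) (Q (r k))) \<longlonglongrightarrow> 1"
    by (rule tendsto_sandwich[OF always_eventually always_eventually tendsto_const lim])
      (use P(2) Adv_ge_1 in blast)+
  then show ?adv using r(1) P(1) by blast
qed

theorem theorem2p21:
  fixes N D :: "nat \<Rightarrow> nat"
    and Q :: "nat \<Rightarrow> (nat \<Rightarrow> real) pmf"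
    and R :: "nat \<Rightarrow> (nat \<Rightarrow> real) set"
  assumes "\<And>n. set_pmf (Q n) \<subseteq> rspace (N n)"
    and "\<And>n. finite (set_pmf (Q n))"
    and "\<And>n. R n \<subseteq> rspace (N n)"
    and "\<And>n. finite (R n)"
  shows
    "((\<nexists>f. (\<forall>n. f n \<in> polys_le (N n) (D n)) \<and> strongly_separates f Q R) \<longleftrightarrow>
      (\<exists>(r :: nat \<Rightarrow> nat) (P :: nat \<Rightarrow> (nat \<Rightarrow> real) pmf).
         strict_mono r \<and> (\<forall>k. set_pmf (P k) \<subseteq> R (r k)) \<and>
         (\<exists>C::real. \<forall>\<^sub>F k in sequentially. Adv (N (r k)) (D (r k)) (P k) (Q (r k)) \<le> ereal C)))
     \<and>
     ((\<nexists>f. (\<forall>n. f n \<in> polys_le (N n) (D n)) \<and> weakly_separates f Q R) \<longleftrightarrow>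
      (\<exists>(r :: nat \<Rightarrow> nat) (P :: nat \<Rightarrow> (nat \<Rightarrow> real) pmf).
         strict_mono r \<and> (\<forall>k. set_pmf (P k) \<subseteq> R (r k)) \<and>
         (\<lambda>k. Adv (N (r k)) (D (r k)) (P k) (Q (r k))) \<longlonglongrightarrow> 1))"
  using strong_equivalence[of Q R N D, OF assms(2,4)] weak_equivalence[of Q R N D, OF assms(2,4)]
  by (rule conjI)

end
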